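(* For every integer $n\ge 3$, the cocktail party graph $CP(n)$ satisfies $\operatorname{st}_{\gamma_{st}}(CP(n))=1$.
   Context: All graphs are finite, simple and undirected. For a graph $G=(V,E)$, a set $D\subseteq V$ is a strong dominating set if every vertex $v\in V\setminus D$ is adjacent to some $u\in D$ with $\deg(v)\le\deg(u)$ (degrees taken in $G$). The strong domination number $\gamma_{st}(G)$ is the minimum size of a strong dominating set. For $S\subseteq V$, $G-S$ is the graph obtained by deleting the vertices of $S$. The stability of the strong domination number is $\operatorname{st}_{\gamma_{st}}(G)=\min\{|S| : S\subseteq V,\ \gamma_{st}(G-S)\ne\gamma_{st}(G)\}$. The cocktail party graph $CP(n)$ is the complete $n$-partite graph with each part of size $2$; equivalently, $K_{2n}$ minus a perfect matching. *)

theory Defs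
  imports
    "Graph_Theory.Digraph_Component"
    "HOL-Library.Disjoint_Sets"
begin

text \<open>
  A finite simple undirected graph is an instance of the locale \<open>graph\<close>: a finite symmetric
  digraph without loops or parallel arcs. The relation \<open>u \<rightarrow>\<^bsub>G\<^esub> v\<close> is then adjacency, and since every
  edge at \<open>v\<close> contributes exactly one arc leaving \<open>v\<close>, \<open>out_degree G v\<close> is the degree of \<open>v\<close>.
  The null graph is a graph; its strong domination number is 0.
\<close>

definition strong_dominating_set :: "('a, 'b) pre_digraph \<Rightarrow> 'a set \<Rightarrow> bool" where
  "strong_dominating_set G D \<longleftrightarrow> D \<subseteq> verts G \<and>
     (\<forall>v \<in> verts G - D. \<exists>u \<in> D. v \<rightarrow>\<^bsub>G\<^esub> u \<and> out_degree G v \<le> out_degree G u)"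

definition strong_domination_number :: "('a, 'b) pre_digraph \<Rightarrow> nat" where
  "strong_domination_number G = Min {card D | D. strong_dominating_set G D}"

definition delete_verts :: "('a, 'b) pre_digraph \<Rightarrow> 'a set \<Rightarrow> ('a, 'b) pre_digraph" where
  "delete_verts G S = G \<restriction> (verts G - S)"

text \<open>
  For a graph with at least one vertex the set below is nonempty, because deleting all vertices
  changes the strong domination number to 0. Only for the null graph is the minimum undefined.
\<close>

definition strong_domination_stability :: "('a, 'b) pre_digraph \<Rightarrow> nat" where
  "strong_domination_stability G =
     Min {card S | S. S \<subseteq> verts G \<and>
            strong_domination_number (delete_verts G S) \<noteq> strong_domination_number G}"

text \<open>
  As with \<open>complete_digraph\<close> and \<open>complete_bipartite_digraph\<close> in theory \<open>Kuratowski\<close>, the following are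
  predicates on graphs: \<open>P\<close> is the set of parts, and \<open>cocktail_party_graph n G\<close> holds for
  exactly the isomorphic copies \<open>G\<close> of \<open>CP(n)\<close>.
\<close>

definition complete_multipartite_digraph :: "'a set set \<Rightarrow> ('a, 'b) pre_digraph \<Rightarrow> bool" where
  "complete_multipartite_digraph P G \<longleftrightarrow> graph G \<and> partition_on (verts G) P \<and>
     arcs_ends G = {(u, v). \<exists>A \<in> P. \<exists>B \<in> P. A \<noteq> B \<and> u \<in> A \<and> v \<in> B}"

definition cocktail_party_graph :: "nat \<Rightarrow> ('a, 'b) pre_digraph \<Rightarrow> bool" where
  "cocktail_party_graph n G \<longleftrightarrow>
     (\<exists>P. card P = n \<and> (\<forall>A \<in> P. card A = 2) \<and> complete_multipartite_digraph P G)"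

lemma cocktail_party_graph_exists:
  "\<exists>G :: (nat \<times> bool, (nat \<times> bool) \<times> (nat \<times> bool)) pre_digraph. cocktail_party_graph n G"
proof -
  define V where "V = {..<n} \<times> (UNIV :: bool set)"
  define H where "H = \<lparr> pverts = V, parcs = {(u, v). u \<in> V \<and> v \<in> V \<and> fst u \<noteq> fst v} \<rparr>"
  define P where "P = (\<lambda>i. {i} \<times> (UNIV :: bool set)) ` {..<n}"
  have "parcs H \<subseteq> V \<times> V" "finite V"
    by (auto simp: H_def V_def)
  then have "finite (parcs H)"
    by (meson finite_SigmaI finite_subset)
  with \<open>finite V\<close> interpret pair_graph H
    by unfold_locales (auto simp: H_def symmetric_def intro: symI)
  have inj: "inj_on (\<lambda>i. {i} \<times> (UNIV :: bool set)) {..<n}"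
    by (auto simp: inj_on_def)
  have "card P = n"
    unfolding P_def using card_image[OF inj] by simp
  moreover have "\<forall>A \<in> P. card A = 2"
    by (auto simp: P_def card_cartesian_product)
  moreover have "partition_on V P"
    by (auto simp: partition_on_def disjoint_def P_def V_def)
  moreover have "parcs H = {(u, v). \<exists>A \<in> P. \<exists>B \<in> P. A \<noteq> B \<and> u \<in> A \<and> v \<in> B}"
    by (auto simp: H_def P_def V_def times_eq_iff)
  moreover have "graph (with_proj H)" by unfold_locales
  ultimately have "cocktail_party_graph n (with_proj H)"
    unfolding cocktail_party_graph_def complete_multipartite_digraph_def
    by (auto simp: H_def)
  then show ?thesis by blast
qed

end

theory Submission
  imports Defs
begin

text \<open>
  A single vertex \<open>u\<close> cannot dominate the other vertex of its part. Once a vertex \<open>v\<close> is deleted, the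
  other vertex of the part of \<open>v\<close> is adjacent to all remaining vertices, so it has maximum degree
  and forms a strong dominating set alone. Hence deleting any one vertex changes the strong
  domination number, and its value on \<open>CP(n)\<close> itself is never needed.
\<close>

lemma (in fin_digraph) finite_card_strong_dominating_sets:
  "finite {card D | D. strong_dominating_set G D}"
  by (rule finite_subset[of _ "card ` Pow (verts G)"]) (auto simp: strong_dominating_set_def)

text \<open>\<open>verts G\<close> dominates vacuously, so the set under \<open>Min\<close> is
  nonempty. Being finite as well, it contains its minimum.\<close>

lemma (in fin_digraph) strong_domination_number_attained:
  obtains D where "strong_dominating_set G D" "card D = strong_domination_number G"
proof -
  have "strong_dominating_set G (verts G)"
    by (simp add: strong_dominating_set_def)
  then have "strong_domination_number G \<in> {card D | D. strong_dominating_set G D}"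
    unfolding strong_domination_number_def
    using Min_in[OF finite_card_strong_dominating_sets] by blast
  then show thesis
    using that by auto
qed

lemma (in fin_digraph) strong_domination_number_le:
  assumes "strong_dominating_set G D"
  shows "strong_domination_number G \<le> card D"
  unfolding strong_domination_number_def
  using assms by (intro Min_le finite_card_strong_dominating_sets) auto

text \<open>With no parallel arcs, an arc leaving \<open>v\<close> is determined by its head.
  Counting vertices instead of arcs lets degrees be compared by inclusion of neighbourhoods.\<close>

lemma (in digraph) out_degree_eq_card_neighbours:
  "out_degree G v = card {u. v \<rightarrow>\<^bsub>G\<^esub> u}"
proof -
  have "inj_on (head G) (out_arcs G v)"
    by (auto simp: inj_on_def arc_to_ends_def intro: no_multi_arcs)
  moreover have "head G ` out_arcs G v = {u. v \<rightarrow>\<^bsub>G\<^esub> u}"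
    by (auto simp: arcs_ends_def arc_to_ends_def)
  ultimately show ?thesis
    by (metis card_image out_degree_def)
qed

text \<open>Without loops, no degree exceeds the number of vertices minus one, and \<open>w\<close>
  attains this bound. The degree condition therefore holds for every vertex that \<open>w\<close>
  has to dominate.\<close>

lemma (in digraph) strong_dominating_set_universal_vertex:
  assumes "w \<in> verts G" and universal: "\<And>v. v \<in> verts G \<Longrightarrow> v \<noteq> w \<Longrightarrow> v \<rightarrow>\<^bsub>G\<^esub> w \<and> w \<rightarrow>\<^bsub>G\<^esub> v"
  shows "strong_dominating_set G {w}"
proof -
  have "out_degree G v \<le> out_degree G w" if "v \<in> verts G" for v
  proof -
    have "{u. v \<rightarrow>\<^bsub>G\<^esub> u} \<subseteq> verts G - {v}"
      by (auto dest: adj_in_verts adj_not_same)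
    then have "out_degree G v \<le> card (verts G - {v})"
      unfolding out_degree_eq_card_neighbours by (intro card_mono) auto
    also have "\<dots> = card (verts G - {w})"
      using that assms(1) by simp
    also have "\<dots> \<le> out_degree G w"
      unfolding out_degree_eq_card_neighbours
    proof (rule card_mono)
      have "{u. w \<rightarrow>\<^bsub>G\<^esub> u} \<subseteq> verts G"
        by (auto dest: adj_in_verts)
      then show "finite {u. w \<rightarrow>\<^bsub>G\<^esub> u}"
        by (rule finite_subset) simp
    qed (use universal in auto)
    finally show ?thesis .
  qed
  with assms show ?thesis
    by (auto simp: strong_dominating_set_def)
qed

lemma (in digraph) strong_domination_number_universal_vertex:
  assumes "w \<in> verts G" and "\<And>v. v \<in> verts G \<Longrightarrow> v \<noteq> w \<Longrightarrow> v \<rightarrow>\<^bsub>G\<^esub> w \<and> w \<rightarrow>\<^bsub>G\<^esub> v"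
  shows "strong_domination_number G = 1"
proof -
  have "strong_domination_number G \<le> 1"
    using strong_domination_number_le[OF strong_dominating_set_universal_vertex[OF assms]] by simp
  moreover obtain D where D: "strong_dominating_set G D" "card D = strong_domination_number G"
    by (rule strong_domination_number_attained)
  \<comment> \<open>The empty set leaves \<open>w\<close> undominated, which excludes the value
    0.\<close>
  moreover have "D \<noteq> {}"
    using D(1) assms(1) by (auto simp: strong_dominating_set_def)
  moreover have "finite D"
    using D(1) finite_subset[of D "verts G"] by (auto simp: strong_dominating_set_def)
  ultimately show ?thesis
    by (metis card_0_eq le_antisym less_one not_le)
qed

text \<open>A minimum of 1 is attained by some \<open>{u}\<close>, and then every other vertex is
  adjacent to \<open>u\<close>.\<close>

lemma (in fin_digraph) strong_domination_number_neq_1: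
  assumes "\<And>u. u \<in> verts G \<Longrightarrow> \<exists>v \<in> verts G. v \<noteq> u \<and> \<not> v \<rightarrow>\<^bsub>G\<^esub> u"
  shows "strong_domination_number G \<noteq> 1"
proof
  assume "strong_domination_number G = 1"
  then obtain D where D: "strong_dominating_set G D" "card D = 1"
    using strong_domination_number_attained by metis
  then obtain u where "D = {u}"
    by (auto simp: card_1_singleton_iff)
  with D(1) assms[of u] show False
    by (auto simp: strong_dominating_set_def)
qed

text \<open>\<open>{v}\<close> witnesses the value 1, so only the value 0 has to be
  excluded.\<close>

lemma (in fin_digraph) strong_domination_stability_eq_1:
  assumes "v \<in> verts G"
    and "strong_domination_number (delete_verts G {v}) \<noteq> strong_domination_number G"
  shows "strong_domination_stability G = 1"
  unfolding strong_domination_stability_def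
proof (rule Min_eqI)
  let ?A = "{card S | S. S \<subseteq> verts G \<and>
    strong_domination_number (delete_verts G S) \<noteq> strong_domination_number G}"
  have "?A \<subseteq> card ` Pow (verts G)"
    by auto
  then show "finite ?A"
    by (rule finite_subset) simp
  have "card {v} \<in> ?A"
    using assms by blast
  then show "1 \<in> ?A"
    by simp
  fix k assume "k \<in> ?A"
  then obtain S where S: "k = card S" "S \<subseteq> verts G"
    "strong_domination_number (delete_verts G S) \<noteq> strong_domination_number G"
    by blast
  \<comment> \<open>Every arc has both ends in \<open>verts G\<close>, so inducing on all vertices
    loses no arc. Thus the empty set changes nothing and is not among the competing sets.\<close>
  have "delete_verts G {} = G"
    by (auto simp: delete_verts_def induce_subgraph_def intro!: pre_digraph.equality)
  with S(3) have "S \<noteq> {}"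
    by auto
  with S(1,2) show "1 \<le> k"
    using finite_subset[of S "verts G"] by (simp add: Suc_le_eq card_gt_0_iff)
qed

theorem proposition2p9:
  fixes G :: "('a, 'b) pre_digraph" and n :: nat
  assumes "n \<ge> 3" and "cocktail_party_graph n G"
  shows "strong_domination_stability G = 1"
proof -
  obtain P where P: "card P = n" "\<And>A. A \<in> P \<Longrightarrow> card A = 2"
    and "graph G" and part: "partition_on (verts G) P"
    and arcs: "arcs_ends G = {(u, v). \<exists>A \<in> P. \<exists>B \<in> P. A \<noteq> B \<and> u \<in> A \<and> v \<in> B}"
    using assms(2) by (auto simp: cocktail_party_graph_def complete_multipartite_digraph_def)
  interpret graph G by fact
  have verts: "verts G = \<Union>P"
    using part by (simp add: partition_on_def)
  have unique: "A = B" if "A \<in> P" "B \<in> P" "x \<in> A" "x \<in> B" for A B x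
    using part that by (auto simp: partition_on_def disjoint_def)
  have "\<exists>v \<in> verts G. v \<noteq> u \<and> \<not> v \<rightarrow>\<^bsub>G\<^esub> u" if "u \<in> verts G" for u
  proof -
    obtain A where A: "A \<in> P" "u \<in> A"
      using \<open>u \<in> verts G\<close> verts by auto
    then obtain v where "v \<in> A" "v \<noteq> u"
      using P(2)[of A] by (auto simp: card_2_iff)
    \<comment> \<open>A vertex determines its part, so two parts witnessing an arc from
      \<open>v\<close> to \<open>u\<close> would both be \<open>A\<close>, whereas arcs require
      distinct parts.\<close>
    have "\<not> v \<rightarrow>\<^bsub>G\<^esub> u"
      using unique[OF _ A(1) _ \<open>v \<in> A\<close>] unique[OF _ A(1) _ A(2)] by (auto simp: arcs)
    with A(1) \<open>v \<in> A\<close> \<open>v \<noteq> u\<close> show ?thesis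
      by (auto simp: verts)
  qed
  then have "strong_domination_number G \<noteq> 1"
    by (rule strong_domination_number_neq_1)
  obtain A where "A \<in> P"
    using P(1) assms(1) by fastforce
  \<comment> \<open>\<open>v\<close> is the vertex to delete; its partner \<open>w\<close> is going
    to be the universal vertex of the rest.\<close>
  then obtain v w where A: "A = {v, w}" "v \<noteq> w"
    using P(2)[of A] by (auto simp: card_2_iff)
  with \<open>A \<in> P\<close> verts have vw: "v \<in> verts G" "w \<in> verts G"
    by auto
  let ?H = "delete_verts G {v}"
  have "digraph ?H"
    unfolding delete_verts_def by (intro digraphI_induced) auto
  moreover have "w \<in> verts ?H"
    using A vw by (simp add: delete_verts_def)
  moreover have "x \<rightarrow>\<^bsub>?H\<^esub> w \<and> w \<rightarrow>\<^bsub>?H\<^esub> x" if "x \<in> verts ?H" "x \<noteq> w" for x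
  proof -
    \<comment> \<open>With \<open>v\<close> deleted, \<open>w\<close> is the only vertex of
      \<open>A\<close> left, so \<open>x\<close> lies in another part and is adjacent to
      \<open>w\<close> in \<open>G\<close>.\<close>
    have x: "x \<in> verts G" "x \<notin> A"
      using that A by (auto simp: delete_verts_def)
    then obtain B where "B \<in> P" "x \<in> B"
      using verts by auto
    moreover have "B \<noteq> A" "w \<in> A"
      using \<open>x \<in> B\<close> x(2) A(1) by auto
    ultimately have "x \<rightarrow>\<^bsub>G\<^esub> w" "w \<rightarrow>\<^bsub>G\<^esub> x"
      unfolding arcs mem_Collect_eq prod.case using \<open>A \<in> P\<close> \<open>x \<in> B\<close> by metis+
    \<comment> \<open>Both arcs between \<open>x\<close> and \<open>w\<close> survive the deletion,
      since neither end is \<open>v\<close>.\<close>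
    with x A vw show ?thesis
      by (auto simp: delete_verts_def arcs_ends_def arc_to_ends_def image_iff)
  qed
  ultimately have "strong_domination_number ?H = 1"
    by (rule digraph.strong_domination_number_universal_vertex)
  with \<open>strong_domination_number G \<noteq> 1\<close> \<open>v \<in> verts G\<close> show ?thesis
    by (intro strong_domination_stability_eq_1) auto
qed

end
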